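(* For $t=1,\ldots,T$, let $\lambda_t$ be the value returned by the Bisection algorithm. Then RAM selects $\mathcal A_t$ such that $|\mathcal A_t|\le\alpha_t$, and the following hold. (i) If $f$ is submodular, with curvature $\kappa_f$, then $$\frac{f(\mathcal A_1\setminus\mathcal B_1^\star,\ldots,\mathcal A_t\setminus\mathcal B_t^\star)}{f_t^\star}\ \ge\ \begin{cases}\dfrac{1-e^{-\kappa_f}}{\kappa_f}\,\dfrac{\hat f_1(\lambda_1)}{f(\mathcal M_1)}, & t=1,\\[3mm] \dfrac{1}{1+\kappa_f}\,\dfrac{\hat f_t(\lambda_t)}{f(\mathcal M_1,\ldots,\mathcal M_t)}, & t>1.\end{cases}$$ (ii) If $f$ is $c_f$-submodular (i.e. $f$ is monotone with total curvature $c_f$), then $$\frac{f(\mathcal A_1\setminus\mathcal B_1^\star,\ldots,\mathcal A_t\setminus\mathcal B_t^\star)}{f_t^\star}\ \ge\ (1-c_f)\,\frac{\hat f_t(\lambda_t)}{f(\mathcal M_1,\ldots,\mathcal M_t)}.$$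
   Context: **Setting.** $T\ge 1$ is an integer; $\mathcal V_1,\ldots,\mathcal V_T$ are finite, pairwise disjoint sets; $\mathcal V=\bigcup_{t=1}^T\mathcal V_t$; $f:2^{\mathcal V}\to\mathbb R$ is non-decreasing with $f(\emptyset)=0$; $\alpha_t,\beta_t$ are integers with $0\le\beta_t\le\alpha_t\le|\mathcal V_t|$. For $\mathcal X_s\subseteq\mathcal V_s$, $f(\mathcal X_1,\ldots,\mathcal X_t)$ denotes $f(\mathcal X_1\cup\cdots\cup\mathcal X_t)$, and $f(v)=f(\{v\})$. **Problem RSM with horizon $t$.** $f_t^\star$ is the optimal value of $$\max_{\mathcal A_1\subseteq\mathcal V_1}\min_{\mathcal B_1\subseteq\mathcal A_1}\cdots\max_{\mathcal A_t\subseteq\mathcal V_t}\min_{\mathcal B_t\subseteq\mathcal A_t} f(\mathcal A_1\setminus\mathcal B_1,\ldots,\mathcal A_t\setminus\mathcal B_t)\quad\text{s.t. } |\mathcal A_s|=\alpha_s,\ |\mathcal B_s|\le\beta_s,\ s=1,\ldots,t.$$ **Algorithm RAM.** At each $t=1,\ldots,T$, having observed the removals $\mathcal B_s\subseteq\mathcal A_s$, $|\mathcal B_s|\le\beta_s$, for $s\le t-1$: (1) sort $\mathcal V_t=\{v_{t,1},\ldots,v_{t,|\mathcal V_t|}\}$ so that $f(v_{t,1})\ge\cdots\ge f(v_{t,|\mathcal V_t|})$ and set $\mathcal S_{t,1}=\{v_{t,1},\ldots,v_{t,\beta_t}\}$; (2) start from $\mathcal S_{t,2}=\emptyset$ and,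 while $|\mathcal S_{t,2}|<\alpha_t-\beta_t$, add to $\mathcal S_{t,2}$ an element $x\in\arg\max_{y\in\mathcal V_t\setminus(\mathcal S_{t,1}\cup\mathcal S_{t,2})} f(\mathcal A_1\setminus\mathcal B_1,\ldots,\mathcal A_{t-1}\setminus\mathcal B_{t-1},\mathcal S_{t,2}\cup\{y\})$; (3) output $\mathcal A_t=\mathcal S_{t,1}\cup\mathcal S_{t,2}$. **Removals.** $\mathcal B_1^\star,\ldots,\mathcal B_T^\star$ are worst-case removals (and are the ones observed by RAM): $\mathcal B_t^\star$ attains $\min_{\mathcal B_t\subseteq\mathcal A_t,\,|\mathcal B_t|\le\beta_t} f(\mathcal A_1\setminus\mathcal B_1^\star,\ldots,\mathcal A_{t-1}\setminus\mathcal B_{t-1}^\star,\mathcal A_t\setminus\mathcal B_t)$. **Failure-free greedy sets $\mathcal M_t$.** With $\mathcal K_t=\mathcal V_t\setminus\mathcal S_{t,1}$ and $\delta_t=\alpha_t-\beta_t$, for $t=1,\ldots,T$ in order: start from $\mathcal M_t=\emptyset$ and, while $|\mathcal M_t|<\delta_t$, add to $\mathcal M_t$ an element of $\arg\max_{y\in\mathcal K_t\setminus\mathcal M_t} f(\mathcal M_1,\ldots,\mathcal M_{t-1},\mathcal M_t\cup\{y\})$. **Penalized problem.** For $\lambda\ge0$, $\hat{\mathcal B}_t(\lambda)$ is an optimal solution: $\hat{\mathcal B}_t(\lambda)\in\arg\min_{\mathcal B_t\subseteq\mathcal A_t} f(\mathcal A_1\setminus\mathcal B_1^\star,\ldots,\mathcal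 A_{t-1}\setminus\mathcal B_{t-1}^\star,\mathcal A_t\setminus\mathcal B_t)+\lambda|\mathcal B_t|$, and $\hat f_t(\lambda)=f(\mathcal A_1\setminus\mathcal B_1^\star,\ldots,\mathcal A_{t-1}\setminus\mathcal B_{t-1}^\star,\mathcal A_t\setminus\hat{\mathcal B}_t(\lambda))$. **Bisection algorithm (at step $t$).** Input: $\epsilon>0$ and $u_0>0$ with $|\hat{\mathcal B}_t(u_0)|<\beta_t$. Set $l=0$, $u=u_0$, $\lambda=(l+u)/2$. While $u-l>\epsilon$: compute $\hat{\mathcal B}_t(\lambda)$; if $|\hat{\mathcal B}_t(\lambda)|<\beta_t$ set $u=\lambda$, else set $l=\lambda$; then set $\lambda=(l+u)/2$. Return $\lambda_t=l$. **Submodularity.** $f$ is submodular if $f(\mathcal A\cup\{v\})-f(\mathcal A)\ge f(\mathcal B\cup\{v\})-f(\mathcal B)$ for all $\mathcal A\subseteq\mathcal B\subseteq\mathcal V$ and $v\in\mathcal V$. **Curvature.** For non-decreasing submodular $f$ with $f(v)\ne0$ for all $v\in\mathcal V$ (assumed whenever $\kappa_f$ is used), $\kappa_f=1-\min_{v\in\mathcal V}\frac{f(\mathcal V)-f(\mathcal V\setminus\{v\})}{f(v)}\in[0,1]$. The quantity $(1-e^{-\kappa_f})/\kappa_f$ is read as its limit $1$ when $\kappa_f=0$. **Total curvature.** For monotone (non-decreasing) $f$, $c_f=1-\min_{v\in\mathcal V}\min_{\mathcal A,\mathcal B\subseteq\mathcal V\setminus\{v\}}\frac{f(\{v\}\cup\mathcal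 A)-f(\mathcal A)}{f(\{v\}\cup\mathcal B)-f(\mathcal B)}\in[0,1]$ (equivalently, the smallest $c\in[0,1]$ such that $f(\{v\}\cup\mathcal A)-f(\mathcal A)\ge(1-c)[f(\{v\}\cup\mathcal B)-f(\mathcal B)]$ for all $v$ and all $\mathcal A,\mathcal B\subseteq\mathcal V\setminus\{v\}$). Any monotone $f$ with total curvature $c_f$ is called $c_f$-submodular. Ratios are understood for positive denominators. *)

theory Defs
  imports "HOL-Analysis.Analysis" "HOL-Library.While_Combinator"
begin

definition ground_set :: "(nat \<Rightarrow> 'a set) \<Rightarrow> nat \<Rightarrow> 'a set" where
  "ground_set V T = (\<Union>t\<in>{1..T}. V t)"

text \<open>What is left of the selections of steps 1 to t; it is empty for \<open>t = 0\<close>.\<close>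

definition survivors :: "(nat \<Rightarrow> 'a set) \<Rightarrow> (nat \<Rightarrow> 'a set) \<Rightarrow> nat \<Rightarrow> 'a set" where
  "survivors A B t = (\<Union>s\<in>{1..t}. A s - B s)"

section \<open>Curvature notions\<close>

definition submodular_on :: "'a set \<Rightarrow> ('a set \<Rightarrow> real) \<Rightarrow> bool" where
  "submodular_on U f \<longleftrightarrow>
     (\<forall>A B v. A \<subseteq> B \<and> B \<subseteq> U \<and> v \<in> U \<longrightarrow> f (A \<union> {v}) - f A \<ge> f (B \<union> {v}) - f B)"

text \<open>Only meaningful if \<open>U\<close> is finite and nonempty and \<open>f\<close> does not vanish on singletons.\<close>

definition curvature :: "'a set \<Rightarrow> ('a set \<Rightarrow> real) \<Rightarrow> real" where
  "curvature U f = 1 - (MIN v\<in>U. (f U - f (U - {v})) / f {v})"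

definition curvature_factor :: "real \<Rightarrow> real" where
  "curvature_factor \<kappa> = (if \<kappa> = 0 then 1 else (1 - exp (- \<kappa>)) / \<kappa>)"

text \<open>
  Only ratios with positive denominator count. The ratio for \<open>A = B\<close> is 1, so inserting 1
  has no effect unless all marginal gains vanish; in that case the total curvature is 0.
\<close>

definition total_curvature :: "'a set \<Rightarrow> ('a set \<Rightarrow> real) \<Rightarrow> real" where
  "total_curvature U f = 1 - Min (insert 1
     {(f ({v} \<union> A) - f A) / (f ({v} \<union> B) - f B) | v A B.
        v \<in> U \<and> A \<subseteq> U - {v} \<and> B \<subseteq> U - {v} \<and> f ({v} \<union> B) - f B > 0})"

definition c_submodular :: "'a set \<Rightarrow> ('a set \<Rightarrow> real) \<Rightarrow> real \<Rightarrow> bool" where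
  "c_submodular U f c \<longleftrightarrow> mono_on (Pow U) f \<and> total_curvature U f = c"

section \<open>The robust sequential maximization problem\<close>

text \<open>
  \<open>rsm_value f V \<alpha> \<beta> ss X\<close> is the value of the game still to be played at the steps \<open>ss\<close> when
  the elements of \<open>X\<close> have survived so far.
\<close>

primrec rsm_value :: "('a set \<Rightarrow> real) \<Rightarrow> (nat \<Rightarrow> 'a set) \<Rightarrow> (nat \<Rightarrow> nat) \<Rightarrow> (nat \<Rightarrow> nat) \<Rightarrow>
    nat list \<Rightarrow> 'a set \<Rightarrow> real" where
  "rsm_value f V \<alpha> \<beta> [] X = f X"
| "rsm_value f V \<alpha> \<beta> (s # ss) X =
     (MAX A\<in>{A. A \<subseteq> V s \<and> card A = \<alpha> s}.
        MIN B\<in>{B. B \<subseteq> A \<and> card B \<le> \<beta> s}. rsm_value f V \<alpha> \<beta> ss (X \<union> (A - B)))"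

definition f_star :: "('a set \<Rightarrow> real) \<Rightarrow> (nat \<Rightarrow> 'a set) \<Rightarrow> (nat \<Rightarrow> nat) \<Rightarrow> (nat \<Rightarrow> nat) \<Rightarrow>
    nat \<Rightarrow> real" where
  "f_star f V \<alpha> \<beta> t = rsm_value f V \<alpha> \<beta> [1..<Suc t] {}"

section \<open>The algorithms\<close>

text \<open>Ties may be broken arbitrarily, so the algorithms are relations.\<close>

definition top_elements :: "('a set \<Rightarrow> real) \<Rightarrow> 'a set \<Rightarrow> nat \<Rightarrow> 'a set \<Rightarrow> bool" where
  "top_elements f U b S \<longleftrightarrow>
     (\<exists>vs. distinct vs \<and> set vs = U \<and> sorted_wrt (\<lambda>x y. f {x} \<ge> f {y}) vs \<and> S = set (take b vs))"

inductive greedy_reachable :: "('a set \<Rightarrow> real) \<Rightarrow> 'a set \<Rightarrow> nat \<Rightarrow> 'a set \<Rightarrow> bool"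
  for g K d where
  start: "greedy_reachable g K d {}"
| step: "greedy_reachable g K d S \<Longrightarrow> card S < d \<Longrightarrow>
    is_arg_max (\<lambda>y. g (S \<union> {y})) (\<lambda>y. y \<in> K - S) x \<Longrightarrow> greedy_reachable g K d (S \<union> {x})"

definition greedy_output :: "('a set \<Rightarrow> real) \<Rightarrow> 'a set \<Rightarrow> nat \<Rightarrow> 'a set \<Rightarrow> bool" where
  "greedy_output g K d S \<longleftrightarrow> greedy_reachable g K d S \<and> \<not> card S < d"

text \<open>
  In \<open>ram_run\<close>, \<open>B\<close> are the observed removals, \<open>S1\<close> the sets chosen by singleton value, and
  \<open>A\<close> the selected sets.
\<close>

definition ram_run :: "('a set \<Rightarrow> real) \<Rightarrow> (nat \<Rightarrow> 'a set) \<Rightarrow> (nat \<Rightarrow> nat) \<Rightarrow> (nat \<Rightarrow> nat) \<Rightarrow> nat \<Rightarrow>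
    (nat \<Rightarrow> 'a set) \<Rightarrow> (nat \<Rightarrow> 'a set) \<Rightarrow> (nat \<Rightarrow> 'a set) \<Rightarrow> bool" where
  "ram_run f V \<alpha> \<beta> T B S1 A \<longleftrightarrow>
     (\<forall>t\<in>{1..T}. top_elements f (V t) (\<beta> t) (S1 t) \<and>
        (\<exists>S2. greedy_output (\<lambda>S. f (survivors A B (t - 1) \<union> S)) (V t - S1 t) (\<alpha> t - \<beta> t) S2 \<and>
              A t = S1 t \<union> S2))"

definition worst_case_removals :: "('a set \<Rightarrow> real) \<Rightarrow> (nat \<Rightarrow> nat) \<Rightarrow> nat \<Rightarrow>
    (nat \<Rightarrow> 'a set) \<Rightarrow> (nat \<Rightarrow> 'a set) \<Rightarrow> bool" where
  "worst_case_removals f \<beta> T A B \<longleftrightarrow>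
     (\<forall>t\<in>{1..T}. is_arg_min (\<lambda>X. f (survivors A B (t - 1) \<union> (A t - X)))
        (\<lambda>X. X \<subseteq> A t \<and> card X \<le> \<beta> t) (B t))"

definition failure_free_greedy :: "('a set \<Rightarrow> real) \<Rightarrow> (nat \<Rightarrow> 'a set) \<Rightarrow> (nat \<Rightarrow> nat) \<Rightarrow>
    (nat \<Rightarrow> nat) \<Rightarrow> nat \<Rightarrow> (nat \<Rightarrow> 'a set) \<Rightarrow> (nat \<Rightarrow> 'a set) \<Rightarrow> bool" where
  "failure_free_greedy f V \<alpha> \<beta> T S1 M \<longleftrightarrow>
     (\<forall>t\<in>{1..T}. greedy_output (\<lambda>S. f ((\<Union>s\<in>{1..<t}. M s) \<union> S))
        (V t - S1 t) (\<alpha> t - \<beta> t) (M t))"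

text \<open>
  The optimal solution for each multiplier is a fixed function \<open>Bhat t\<close>: bisection and the
  value \<open>f_hat\<close> must refer to the same minimizer when several exist.
\<close>

definition penalized_solutions :: "('a set \<Rightarrow> real) \<Rightarrow> nat \<Rightarrow>
    (nat \<Rightarrow> 'a set) \<Rightarrow> (nat \<Rightarrow> 'a set) \<Rightarrow> (nat \<Rightarrow> real \<Rightarrow> 'a set) \<Rightarrow> bool" where
  "penalized_solutions f T A B Bhat \<longleftrightarrow>
     (\<forall>t\<in>{1..T}. \<forall>l\<ge>0.
        is_arg_min (\<lambda>X. f (survivors A B (t - 1) \<union> (A t - X)) + l * real (card X))
          (\<lambda>X. X \<subseteq> A t) (Bhat t l))"

definition f_hat :: "('a set \<Rightarrow> real) \<Rightarrow> (nat \<Rightarrow> 'a set) \<Rightarrow> (nat \<Rightarrow> 'a set) \<Rightarrow>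
    (nat \<Rightarrow> real \<Rightarrow> 'a set) \<Rightarrow> nat \<Rightarrow> real \<Rightarrow> real" where
  "f_hat f A B Bhat t l = f (survivors A B (t - 1) \<union> (A t - Bhat t l))"

definition bisection :: "(real \<Rightarrow> 'a set) \<Rightarrow> nat \<Rightarrow> real \<Rightarrow> real \<Rightarrow> real" where
  "bisection Bh b \<epsilon> u0 =
     fst (while (\<lambda>(l, u). u - l > \<epsilon>)
            (\<lambda>(l, u). let m = (l + u) / 2 in if card (Bh m) < b then (l, m) else (m, u))
            (0, u0))"

definition bisection_returns :: "(real \<Rightarrow> 'a set) \<Rightarrow> nat \<Rightarrow> real \<Rightarrow> bool" where
  "bisection_returns Bh b l \<longleftrightarrow>
     (\<exists>\<epsilon> u0. \<epsilon> > 0 \<and> u0 > 0 \<and> card (Bh u0) < b \<and> l = bisection Bh b \<epsilon> u0)"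

end

theory Submission
  imports Defs
begin

text \<open>
  Bisection only returns multipliers \<open>l\<close> with \<open>l = 0\<close> or at least \<open>\<beta> t\<close> penalized removals, so
  comparing the penalized minimizer with the worst-case removal shows that \<open>f_hat\<close> is at most the
  value of the survivors. On the other hand, the adversary of the robust problem can always
  discard the elements of \<open>S1 s\<close>, so \<open>f_star\<close> is at most the value of some choice of
  \<open>\<alpha> s - \<beta> s\<close> elements of \<open>V s - S1 s\<close> for each \<open>s\<close>. The failure-free greedy sets compete with
  such a choice: an exchange argument within each step gives the factors \<open>1 - c\<close> and
  \<open>1 / (1 + \<kappa>)\<close>, and for a single step the argument of Conforti and Cornuejols gives
  \<open>(1 - exp (- \<kappa>)) / \<kappa>\<close>.
\<close>

section \<open>Marginal gains\<close>

definition gain :: "('a set \<Rightarrow> real) \<Rightarrow> 'a \<Rightarrow> 'a set \<Rightarrow> real" where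
  "gain f v S = f (insert v S) - f S"

lemma gain_nonneg:
  assumes "mono_on (Pow U) f" "insert v S \<subseteq> U"
  shows "gain f v S \<ge> 0"
  unfolding gain_def using mono_onD[OF assms(1), of S "insert v S"] assms(2) by auto

lemma gain_antimono:
  assumes "submodular_on U f" "X \<subseteq> Y" "Y \<subseteq> U" "v \<in> U"
  shows "gain f v Y \<le> gain f v X"
  using assms unfolding submodular_on_def gain_def by fastforce

text \<open>Insert the elements of \<open>S\<close> one at a time; \<open>Q v\<close> is the set
  present just before \<open>v\<close>. Only \<open>v\<close> being absent from \<open>Q v\<close>
  is recorded, which is all that total curvature asks of a context.\<close>

lemma sum_gain_telescope:
  assumes "finite S"
  shows "\<exists>Q. (\<forall>v\<in>S. Q v \<subseteq> S - {v}) \<and> (\<Sum>v\<in>S. gain f v (Q v)) = f S - f {}"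
  using assms
proof (induction S rule: finite_induct)
  case empty
  then show ?case by simp
next
  case (insert x S)
  then obtain Q where Q: "\<forall>v\<in>S. Q v \<subseteq> S - {v}" "(\<Sum>v\<in>S. gain f v (Q v)) = f S - f {}"
    by blast
  have "(\<Sum>v\<in>S. gain f v ((Q(x := S)) v)) = (\<Sum>v\<in>S. gain f v (Q v))"
    by (rule sum.cong) (use insert in auto)
  then show ?case
    using Q insert by (intro exI[of _ "Q(x := S)"]) (auto simp: gain_def)
qed

text \<open>Insert \<open>C\<close> one element at a time: each gain is at most the gain on
  \<open>S\<close> alone. Elements of \<open>C\<close> already in \<open>S\<close> contribute
  zero.\<close>

lemma submodular_union_le:
  assumes "submodular_on U f" "S \<subseteq> U" "C \<subseteq> U" "finite C"
  shows "f (S \<union> C) \<le> f S + (\<Sum>v\<in>C. gain f v S)"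
  using assms(4,3)
proof (induction C rule: finite_induct)
  case empty
  then show ?case by simp
next
  case (insert x C)
  have "gain f x (S \<union> C) \<le> gain f x S"
    by (rule gain_antimono[OF assms(1)]) (use insert assms in auto)
  then show ?case
    using insert by (simp add: gain_def)
qed

text \<open>By submodularity the gain of \<open>v\<close> on \<open>U - {v}\<close> is its smallest
  gain over sets avoiding \<open>v\<close>, and the curvature is one minus the smallest ratio of
  this gain to \<open>f {v}\<close>.\<close>

lemma curvature_bounds:
  assumes U: "finite U" "U \<noteq> {}" and mono: "mono_on (Pow U) f" and f0: "f {} = 0"
    and sub: "submodular_on U f" and nz: "\<forall>v\<in>U. f {v} \<noteq> 0"
  shows "0 \<le> curvature U f" "curvature U f \<le> 1"
    and "\<And>v S. v \<in> U \<Longrightarrow> S \<subseteq> U \<Longrightarrow> v \<notin> S \<Longrightarrow> (1 - curvature U f) * f {v} \<le> gain f v S"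
proof -
  define R where "R = (\<lambda>v. (f U - f (U - {v})) / f {v})"
  have pos: "f {v} > 0" if "v \<in> U" for v
  proof -
    have "f {} \<le> f {v}"
      by (rule mono_onD[OF mono]) (use that in auto)
    then show ?thesis
      using nz that f0 by (simp add: less_le)
  qed
  have last: "f U - f (U - {v}) = gain f v (U - {v})" if "v \<in> U" for v
    using that by (simp add: gain_def insert_absorb)
  have R01: "0 \<le> R v \<and> R v \<le> 1" if "v \<in> U" for v
  proof -
    have "gain f v (U - {v}) \<ge> 0"
      by (rule gain_nonneg[OF mono]) (use that in auto)
    moreover have "gain f v (U - {v}) \<le> gain f v {}"
      by (rule gain_antimono[OF sub]) (use that in auto)
    ultimately show ?thesis
      using last[OF that] pos[OF that] f0 by (simp add: R_def gain_def)
  qed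
  have c: "1 - curvature U f = Min (R ` U)"
    by (simp add: curvature_def R_def)
  have "Min (R ` U) \<in> R ` U"
    using U by (intro Min_in) auto
  then show "0 \<le> curvature U f" "curvature U f \<le> 1"
    using R01 c by fastforce+
  fix v S assume v: "v \<in> U" and S: "S \<subseteq> U" "v \<notin> S"
  have "Min (R ` U) \<le> R v"
    using U v by auto
  then have "Min (R ` U) * f {v} \<le> gain f v (U - {v})"
    using pos[OF v] last[OF v] by (simp add: R_def pos_le_divide_eq)
  also have "\<dots> \<le> gain f v S"
    by (rule gain_antimono[OF sub]) (use v S in auto)
  finally show "(1 - curvature U f) * f {v} \<le> gain f v S"
    by (simp add: c)
qed

text \<open>The lower counterpart of \<open>submodular_union_le\<close>: each inserted element keeps
  at least the fraction \<open>1 - \<kappa>\<close> of its singleton value. Only the inequality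
  \<open>curv\<close> is assumed of \<open>\<kappa>\<close>, not the formula defining
  curvature.\<close>

lemma curvature_union_ge:
  fixes \<kappa> :: real
  assumes curv: "\<And>v S. v \<in> U \<Longrightarrow> S \<subseteq> U \<Longrightarrow> v \<notin> S \<Longrightarrow> (1 - \<kappa>) * f {v} \<le> gain f v S"
    and "S \<subseteq> U" "C \<subseteq> U" "finite C" "S \<inter> C = {}"
  shows "f S + (1 - \<kappa>) * (\<Sum>v\<in>C. f {v}) \<le> f (S \<union> C)"
  using assms(4,3,5)
proof (induction C rule: finite_induct)
  case empty
  then show ?case by simp
next
  case (insert x C)
  have "(1 - \<kappa>) * f {x} \<le> gain f x (S \<union> C)"
    by (rule curv) (use insert assms in auto)
  then show ?case
    using insert by (simp add: gain_def algebra_simps)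
qed

lemma total_curvature_bounds:
  assumes U: "finite U" and mono: "mono_on (Pow U) f"
  shows "total_curvature U f \<le> 1"
    and "\<And>v X Y. v \<in> U \<Longrightarrow> X \<subseteq> U - {v} \<Longrightarrow> Y \<subseteq> U - {v} \<Longrightarrow>
           (1 - total_curvature U f) * gain f v Y \<le> gain f v X"
proof -
  define R where "R = {(f ({v} \<union> A) - f A) / (f ({v} \<union> B) - f B) | v A B.
        v \<in> U \<and> A \<subseteq> U - {v} \<and> B \<subseteq> U - {v} \<and> f ({v} \<union> B) - f B > 0}"
  have "R \<subseteq> (\<lambda>(v, A, B). (f ({v} \<union> A) - f A) / (f ({v} \<union> B) - f B)) ` (U \<times> Pow U \<times> Pow U)"
    unfolding R_def by force
  then have fin: "finite R"
    by (rule finite_subset) (use U in auto)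
  have c: "1 - total_curvature U f = Min (insert 1 R)"
    by (simp add: total_curvature_def R_def)
  have "r \<ge> 0" if rR: "r \<in> R" for r
  proof -
    obtain v A B where r: "r = gain f v A / gain f v B"
      and "v \<in> U" "A \<subseteq> U - {v}" "gain f v B > 0"
      using rR unfolding R_def gain_def by auto
    moreover have "gain f v A \<ge> 0"
      by (rule gain_nonneg[OF mono]) (use calculation in auto)
    ultimately show ?thesis by simp
  qed
  then have "Min (insert 1 R) \<ge> 0"
    using fin by (subst Min_ge_iff) auto
  then show "total_curvature U f \<le> 1"
    using c by linarith
  fix v X Y assume v: "v \<in> U" and X: "X \<subseteq> U - {v}" and Y: "Y \<subseteq> U - {v}"
  have "gain f v X \<ge> 0" "gain f v Y \<ge> 0"
    by (rule gain_nonneg[OF mono]; use v X Y in auto)+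
  \<comment> \<open>Contexts with zero gain give no ratio in \<open>R\<close>; for them monotonicity
    suffices.\<close>
  then consider "gain f v Y = 0" | "gain f v Y > 0"
    by linarith
  then show "(1 - total_curvature U f) * gain f v Y \<le> gain f v X"
  proof cases
    case 1
    then show ?thesis using \<open>gain f v X \<ge> 0\<close> by simp
  next
    case 2
    then have "gain f v X / gain f v Y \<in> R"
      unfolding R_def gain_def using v X Y by fastforce
    then have "Min (insert 1 R) \<le> gain f v X / gain f v Y"
      using fin by auto
    then show ?thesis
      using 2 c by (simp add: pos_le_divide_eq)
  qed
qed

section \<open>Greedy selection\<close>

lemma greedy_reachable_bounds:
  assumes "greedy_reachable g K d S"
  shows "S \<subseteq> K \<and> finite S \<and> card S \<le> d"
  using assms
proof induction
  case start
  then show ?case by simp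
next
  case (step S x)
  then show ?case by (auto simp: is_arg_max_def)
qed

lemma greedy_output_bounds:
  assumes "greedy_output g K d S"
  shows "S \<subseteq> K" "finite S" "card S = d"
  using assms greedy_reachable_bounds unfolding greedy_output_def by (force, force, force)

text \<open>\<open>P m\<close> is the set present when \<open>m\<close> was picked, namely
  \<open>X\<close> and the earlier picks. Every element never picked was still a candidate at that
  moment, so its gain there is at most that of \<open>m\<close>.\<close>

lemma greedy_reachable_gain:
  assumes "greedy_reachable (\<lambda>S. f (X \<union> S)) K d S" "X \<inter> K = {}"
  shows "\<exists>P. (\<forall>m\<in>S. P m \<subseteq> X \<union> S - {m} \<and> (\<forall>v\<in>K - S. gain f v (P m) \<le> gain f m (P m))) \<and>
             (\<Sum>m\<in>S. gain f m (P m)) = f (X \<union> S) - f X"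
  using assms
proof induction
  case start
  then show ?case by simp
next
  case (step S x)
  obtain P where P: "\<forall>m\<in>S. P m \<subseteq> X \<union> S - {m} \<and> (\<forall>v\<in>K - S. gain f v (P m) \<le> gain f m (P m))"
      "(\<Sum>m\<in>S. gain f m (P m)) = f (X \<union> S) - f X"
    using step by blast
  have S: "S \<subseteq> K" "finite S"
    using greedy_reachable_bounds[OF step.hyps(1)] by auto
  have x: "x \<in> K" "x \<notin> S" "x \<notin> X" and best: "\<forall>v\<in>K - S. f (insert v (X \<union> S)) \<le> f (insert x (X \<union> S))"
    using step.hyps(3) step.prems by (auto simp: is_arg_max_def not_less)
  \<comment> \<open>Older contexts stay as they are. Their dominance property survives because the
    set of unpicked candidates only shrinks.\<close>
  define P' where "P' = P(x := X \<union> S)"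
  have "(\<Sum>m\<in>S. gain f m (P' m)) = (\<Sum>m\<in>S. gain f m (P m))"
    by (rule sum.cong) (use x in \<open>auto simp: P'_def\<close>)
  then have "(\<Sum>m\<in>S \<union> {x}. gain f m (P' m)) = f (X \<union> (S \<union> {x})) - f X"
    using P(2) S x by (simp add: P'_def gain_def)
  moreover have "\<forall>m\<in>S \<union> {x}. P' m \<subseteq> X \<union> (S \<union> {x}) - {m} \<and>
      (\<forall>v\<in>K - (S \<union> {x}). gain f v (P' m) \<le> gain f m (P' m))"
  proof
    fix m assume m: "m \<in> S \<union> {x}"
    show "P' m \<subseteq> X \<union> (S \<union> {x}) - {m} \<and>
      (\<forall>v\<in>K - (S \<union> {x}). gain f v (P' m) \<le> gain f m (P' m))"
    proof (cases "m = x")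
      case True
      then show ?thesis
        using x best by (auto simp: P'_def gain_def)
    next
      case False
      then show ?thesis
        using m P(1) by (fastforce simp: P'_def)
    qed
  qed
  ultimately show ?case by blast
qed

section \<open>The exchange argument for greedy selection over disjoint sets\<close>

lemma sum_le_sum_same_card:
  fixes r g :: "'a \<Rightarrow> real"
  assumes "finite X" "finite Y" "card X = card Y" "\<And>x y. x \<in> X \<Longrightarrow> y \<in> Y \<Longrightarrow> r x \<le> g y"
  shows "sum r X \<le> sum g Y"
proof -
  \<comment> \<open>Any bijection will do, as each value on the left is below every value on the
    right.\<close>
  obtain \<sigma> where \<sigma>: "bij_betw \<sigma> X Y"
    using finite_same_card_bij[OF assms(1-3)] by blast
  have "sum r X \<le> (\<Sum>x\<in>X. g (\<sigma> x))"
    using \<sigma> assms(4) by (intro sum_mono) (auto dest: bij_betwE)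
  also have "\<dots> = sum g Y"
    by (rule sum.reindex_bij_betw[OF \<sigma>])
  finally show ?thesis .
qed

lemma card_Diff_eq_card_Diff:
  assumes "finite X" "finite Y" "card X = card Y"
  shows "card (X - Y) = card (Y - X)"
  using assms by (simp add: card_Diff_subset_Int Int_commute)

text \<open>Apply \<open>greedy_reachable_gain\<close> at each step, with the union of the earlier
  selections as starting context; the gains then telescope over the steps as well.\<close>

lemma sequential_greedy_gain:
  fixes t :: nat
  assumes disj: "disjoint_family_on K {1..t}"
    and greedy: "\<And>s. s \<in> {1..t} \<Longrightarrow> greedy_output (\<lambda>S. f ((\<Union>r\<in>{1..<s}. M r) \<union> S)) (K s) (d s) (M s)"
    and f0: "f {} = 0"
  obtains P where
    "\<forall>s\<in>{1..t}. \<forall>m\<in>M s. P s m \<subseteq> (\<Union>r\<in>{1..t}. M r) - {m} \<and>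
       (\<forall>v\<in>K s - M s. v \<notin> P s m \<and> gain f v (P s m) \<le> gain f m (P s m))"
    "(\<Sum>s\<in>{1..t}. \<Sum>m\<in>M s. gain f m (P s m)) = f (\<Union>s\<in>{1..t}. M s)"
proof -
  let ?N = "\<lambda>s. \<Union>r\<in>{1..<s}. M r"
  \<comment> \<open>This keeps an unpicked \<open>v\<close> of \<open>K s\<close> out of all
    contexts of step \<open>s\<close>.\<close>
  have dis: "?N s \<inter> K s = {}" if s: "s \<in> {1..t}" for s
  proof -
    have "M r \<inter> K s = {}" if "r \<in> {1..<s}" for r
    proof -
      have "M r \<subseteq> K r"
        by (rule greedy_output_bounds(1)[OF greedy]) (use that s in auto)
      moreover have "K r \<inter> K s = {}"
        using disj that s by (auto simp: disjoint_family_on_def)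
      ultimately show ?thesis by auto
    qed
    then show ?thesis by blast
  qed
  have "\<forall>s\<in>{1..t}. \<exists>P. (\<forall>m\<in>M s. P m \<subseteq> ?N s \<union> M s - {m} \<and>
           (\<forall>v\<in>K s - M s. gain f v (P m) \<le> gain f m (P m))) \<and>
         (\<Sum>m\<in>M s. gain f m (P m)) = f (?N s \<union> M s) - f (?N s)"
    using greedy unfolding greedy_output_def by (intro ballI greedy_reachable_gain dis) auto
  then obtain P where P: "\<forall>s\<in>{1..t}. (\<forall>m\<in>M s. P s m \<subseteq> ?N s \<union> M s - {m} \<and>
           (\<forall>v\<in>K s - M s. gain f v (P s m) \<le> gain f m (P s m))) \<and>
         (\<Sum>m\<in>M s. gain f m (P s m)) = f (?N s \<union> M s) - f (?N s)"
    by (rule bchoice[THEN exE])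
  have N_Suc: "?N s \<union> M s = ?N (Suc s)" if "s \<in> {1..t}" for s
    using that by (auto simp: atLeastLessThanSuc)
  show thesis
  proof (rule that, intro ballI conjI)
    fix s m assume s: "s \<in> {1..t}" and m: "m \<in> M s"
    have "P s m \<subseteq> ?N s \<union> M s - {m}"
      using bspec[OF P s] m by blast
    moreover have "?N s \<union> M s \<subseteq> (\<Union>r\<in>{1..t}. M r)"
      using s by force
    ultimately show "P s m \<subseteq> (\<Union>r\<in>{1..t}. M r) - {m}" by blast
    fix v assume v: "v \<in> K s - M s"
    then show "v \<notin> P s m" "gain f v (P s m) \<le> gain f m (P s m)"
      using bspec[OF P s] m dis[OF s] by blast+
  next
    have "(\<Sum>s\<in>{1..t}. \<Sum>m\<in>M s. gain f m (P s m)) = (\<Sum>s\<in>{1..t}. f (?N (Suc s)) - f (?N s))"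
      by (rule sum.cong) (use P N_Suc in auto)
    also have "\<dots> = f (?N (Suc t)) - f (?N 1)"
      by (rule sum_Suc_diff) simp
    also have "\<dots> = f (\<Union>s\<in>{1..t}. M s)"
      using f0 by (simp add: atLeastLessThanSuc_atLeastAtMost)
    finally show "(\<Sum>s\<in>{1..t}. \<Sum>m\<in>M s. gain f m (P s m)) = f (\<Union>s\<in>{1..t}. M s)" .
  qed
qed

text \<open>Split the value of the competitor into gains. Scaled by \<open>1 - c\<close>, the gain
  of \<open>v\<close> can be moved to any context avoiding \<open>v\<close>, in particular to the
  one in which greedy preferred another element to \<open>v\<close>.\<close>

lemma sequential_greedy_total_curvature:
  fixes t :: nat and f :: "'a set \<Rightarrow> real"
  assumes disj: "disjoint_family_on K {1..t}"
    and KU: "\<And>s. s \<in> {1..t} \<Longrightarrow> K s \<subseteq> U" and U: "finite U"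
    and mono: "mono_on (Pow U) f" and f0: "f {} = 0"
    and greedy: "\<And>s. s \<in> {1..t} \<Longrightarrow> greedy_output (\<lambda>S. f ((\<Union>r\<in>{1..<s}. M r) \<union> S)) (K s) (d s) (M s)"
    and Opt: "\<And>s. s \<in> {1..t} \<Longrightarrow> Opt s \<subseteq> K s \<and> card (Opt s) = d s"
  shows "(1 - total_curvature U f) * f (\<Union>s\<in>{1..t}. Opt s) \<le> f (\<Union>s\<in>{1..t}. M s)"
proof -
  let ?c = "1 - total_curvature U f" and ?O = "\<Union>s\<in>{1..t}. Opt s" and ?M = "\<Union>s\<in>{1..t}. M s"
  obtain P where P':
    "\<forall>s\<in>{1..t}. \<forall>m\<in>M s. P s m \<subseteq> ?M - {m} \<and>
       (\<forall>v\<in>K s - M s. v \<notin> P s m \<and> gain f v (P s m) \<le> gain f m (P s m))"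
    "(\<Sum>s\<in>{1..t}. \<Sum>m\<in>M s. gain f m (P s m)) = f ?M"
    by (rule sequential_greedy_gain[OF disj greedy f0]) blast
  have P: "P s m \<subseteq> ?M - {m}"
    "v \<in> K s - M s \<Longrightarrow> v \<notin> P s m \<and> gain f v (P s m) \<le> gain f m (P s m)"
    if "s \<in> {1..t}" "m \<in> M s" for s m v
    using P'(1) that by blast+
  have MK: "M s \<subseteq> K s" "finite (M s)" "card (M s) = d s" if "s \<in> {1..t}" for s
    using greedy_output_bounds[OF greedy[OF that]] by auto
  have finO: "finite (Opt s)" if "s \<in> {1..t}" for s
    using Opt[OF that] KU[OF that] U by (meson finite_subset)
  have MU: "?M \<subseteq> U" and OU: "?O \<subseteq> U"
    using MK(1) Opt KU by blast+
  have "finite ?O"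
    by (intro finite_UN_I finO) auto
  then obtain Q where Q: "\<forall>v\<in>?O. Q v \<subseteq> ?O - {v}" "(\<Sum>v\<in>?O. gain f v (Q v)) = f ?O"
    using sum_gain_telescope[of ?O f] f0 by auto
  let ?r = "\<lambda>v. ?c * gain f v (Q v)"
  have r: "?r v \<le> gain f v X" if "v \<in> ?O" "X \<subseteq> U - {v}" for v X
    by (rule total_curvature_bounds(2)[OF U mono]) (use that Q OU in blast)+
  have stage: "(\<Sum>v\<in>Opt s. ?r v) \<le> (\<Sum>m\<in>M s. gain f m (P s m))" if s: "s \<in> {1..t}" for s
  proof -
    \<comment> \<open>Elements missed by greedy are paired with greedy elements outside the
      competitor; both sets have the same size.\<close>
    have "(\<Sum>v\<in>Opt s - M s. ?r v) \<le> (\<Sum>m\<in>M s - Opt s. gain f m (P s m))"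
    proof (rule sum_le_sum_same_card)
      show "card (Opt s - M s) = card (M s - Opt s)"
        using Opt[OF s] MK[OF s] finO[OF s] by (intro card_Diff_eq_card_Diff) auto
      fix v m assume v: "v \<in> Opt s - M s" and m: "m \<in> M s - Opt s"
      have *: "v \<notin> P s m \<and> gain f v (P s m) \<le> gain f m (P s m)"
        by (rule P(2)[OF s]) (use v m Opt[OF s] in auto)
      have "?r v \<le> gain f v (P s m)"
        by (rule r) (use v m s P(1)[OF s, of m] MU * in blast)+
      with * show "?r v \<le> gain f m (P s m)" by linarith
    qed (use MK[OF s] finO[OF s] in auto)
    \<comment> \<open>A common element is compared with itself, in the context in which greedy
      picked it.\<close>
    moreover have "(\<Sum>v\<in>Opt s \<inter> M s. ?r v) \<le> (\<Sum>m\<in>M s \<inter> Opt s. gain f m (P s m))"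
      unfolding Int_commute[of "M s"]
    proof (rule sum_mono)
      fix v assume v: "v \<in> Opt s \<inter> M s"
      show "?r v \<le> gain f v (P s v)"
        by (rule r) (use v s P(1)[OF s, of v] MU in blast)+
    qed
    moreover have "sum h X = sum h (X \<inter> Y) + sum h (X - Y)" if "finite X" for h :: "'a \<Rightarrow> real" and X Y
      by (rule sum.Int_Diff[OF that])
    ultimately show ?thesis
      using MK(2)[OF s] finO[OF s] by (smt (verit))
  qed
  have "Opt i \<inter> Opt j = {}" if "i \<in> {1..t}" "j \<in> {1..t}" "i \<noteq> j" for i j
  proof -
    have "K i \<inter> K j = {}"
      using disj that by (auto simp: disjoint_family_on_def)
    then show ?thesis
      using Opt that by blast
  qed
  then have "(\<Sum>v\<in>?O. ?r v) = (\<Sum>s\<in>{1..t}. \<Sum>v\<in>Opt s. ?r v)"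
    using finO by (intro sum.UNION_disjoint) auto
  moreover have "\<dots> \<le> (\<Sum>s\<in>{1..t}. \<Sum>m\<in>M s. gain f m (P s m))"
    by (rule sum_mono[OF stage])
  moreover have "(\<Sum>v\<in>?O. ?r v) = ?c * f ?O"
    using Q(2) by (simp add: sum_distrib_left[symmetric])
  ultimately show ?thesis
    using P'(2) by linarith
qed

text \<open>Let \<open>G\<close> be the gain of the greedy elements outside the competitor. The
  value of \<open>?O \<union> ?M\<close> is at most \<open>f ?M + G\<close> by exchange and at least
  \<open>f ?O + (1 - \<kappa>) * G\<close> by curvature. Hence
  \<open>f ?O \<le> f ?M + \<kappa> * G\<close>, and \<open>G \<le> f ?M\<close>.\<close>

lemma sequential_greedy_curvature:
  fixes t :: nat and \<kappa> :: real and f :: "'a set \<Rightarrow> real"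
  assumes disj: "disjoint_family_on K {1..t}"
    and KU: "\<And>s. s \<in> {1..t} \<Longrightarrow> K s \<subseteq> U" and U: "finite U"
    and mono: "mono_on (Pow U) f" and f0: "f {} = 0" and sub: "submodular_on U f"
    and \<kappa>: "0 \<le> \<kappa>" "\<kappa> \<le> 1"
    and curv: "\<And>v S. v \<in> U \<Longrightarrow> S \<subseteq> U \<Longrightarrow> v \<notin> S \<Longrightarrow> (1 - \<kappa>) * f {v} \<le> gain f v S"
    and greedy: "\<And>s. s \<in> {1..t} \<Longrightarrow> greedy_output (\<lambda>S. f ((\<Union>r\<in>{1..<s}. M r) \<union> S)) (K s) (d s) (M s)"
    and Opt: "\<And>s. s \<in> {1..t} \<Longrightarrow> Opt s \<subseteq> K s \<and> card (Opt s) = d s"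
  shows "f (\<Union>s\<in>{1..t}. Opt s) \<le> (1 + \<kappa>) * f (\<Union>s\<in>{1..t}. M s)"
proof -
  let ?O = "\<Union>s\<in>{1..t}. Opt s" and ?M = "\<Union>s\<in>{1..t}. M s"
  obtain P where P':
    "\<forall>s\<in>{1..t}. \<forall>m\<in>M s. P s m \<subseteq> ?M - {m} \<and>
       (\<forall>v\<in>K s - M s. v \<notin> P s m \<and> gain f v (P s m) \<le> gain f m (P s m))"
    "(\<Sum>s\<in>{1..t}. \<Sum>m\<in>M s. gain f m (P s m)) = f ?M"
    by (rule sequential_greedy_gain[OF disj greedy f0]) blast
  have P: "P s m \<subseteq> ?M - {m}"
    "v \<in> K s - M s \<Longrightarrow> v \<notin> P s m \<and> gain f v (P s m) \<le> gain f m (P s m)"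
    if "s \<in> {1..t}" "m \<in> M s" for s m v
    using P'(1) that by blast+
  have MK: "M s \<subseteq> K s" "finite (M s)" "card (M s) = d s" if "s \<in> {1..t}" for s
    using greedy_output_bounds[OF greedy[OF that]] by auto
  have finO: "finite (Opt s)" if "s \<in> {1..t}" for s
    using Opt[OF that] KU[OF that] U by (meson finite_subset)
  have MU: "?M \<subseteq> U" and OU: "?O \<subseteq> U"
    using MK(1) Opt KU by blast+
  have disj': "K i \<inter> K j = {}" if "i \<in> {1..t}" "j \<in> {1..t}" "i \<noteq> j" for i j
    using disj that by (auto simp: disjoint_family_on_def)
  \<comment> \<open>Differences of the unions can thus be taken step by step, where greedy sets and
    competitor have equal size.\<close>
  have cross: "Opt i \<inter> M j = {}" if "i \<in> {1..t}" "j \<in> {1..t}" "i \<noteq> j" for i j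
    using disj'[OF that] Opt[OF that(1)] MK(1)[OF that(2)] by blast
  have OM: "?O - ?M = (\<Union>s\<in>{1..t}. Opt s - M s)" and MO: "?M - ?O = (\<Union>s\<in>{1..t}. M s - Opt s)"
    using cross by fast+
  have sO: "(\<Sum>v\<in>?O - ?M. h v) = (\<Sum>s\<in>{1..t}. \<Sum>v\<in>Opt s - M s. h v)" for h :: "'a \<Rightarrow> real"
    unfolding OM
  proof (rule sum.UNION_disjoint)
    show "\<forall>i\<in>{1..t}. \<forall>j\<in>{1..t}. i \<noteq> j \<longrightarrow> (Opt i - M i) \<inter> (Opt j - M j) = {}"
      using disj' Opt by blast
  qed (use finO in auto)
  have sM: "(\<Sum>v\<in>?M - ?O. h v) = (\<Sum>s\<in>{1..t}. \<Sum>v\<in>M s - Opt s. h v)" for h :: "'a \<Rightarrow> real"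
    unfolding MO
  proof (rule sum.UNION_disjoint)
    show "\<forall>i\<in>{1..t}. \<forall>j\<in>{1..t}. i \<noteq> j \<longrightarrow> (M i - Opt i) \<inter> (M j - Opt j) = {}"
      using disj' MK(1) by blast
  qed (use MK(2) in auto)
  define G where "G = (\<Sum>s\<in>{1..t}. \<Sum>m\<in>M s - Opt s. gain f m (P s m))"
  have g0: "gain f m (P s m) \<ge> 0" if "s \<in> {1..t}" "m \<in> M s" for s m
    by (rule gain_nonneg[OF mono]) (use P(1)[OF that] MU that in force)
  have "(\<Sum>v\<in>?O - ?M. gain f v ?M) \<le> G"
    unfolding sO G_def
  proof (rule sum_mono)
    fix s assume s: "s \<in> {1..t}"
    show "(\<Sum>v\<in>Opt s - M s. gain f v ?M) \<le> (\<Sum>m\<in>M s - Opt s. gain f m (P s m))"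
    proof (rule sum_le_sum_same_card)
      show "card (Opt s - M s) = card (M s - Opt s)"
        using Opt[OF s] MK[OF s] finO[OF s] by (intro card_Diff_eq_card_Diff) auto
      fix v m assume v: "v \<in> Opt s - M s" and m: "m \<in> M s - Opt s"
      have "gain f v ?M \<le> gain f v (P s m)"
        by (rule gain_antimono[OF sub _ MU]) (use P(1)[OF s] v m OU s in force)+
      also have "\<dots> \<le> gain f m (P s m)"
        using P(2)[OF s, of m v] v m Opt[OF s] by auto
      finally show "gain f v ?M \<le> gain f m (P s m)" .
    qed (use MK[OF s] finO[OF s] in auto)
  qed
  moreover have "f (?M \<union> (?O - ?M)) \<le> f ?M + (\<Sum>v\<in>?O - ?M. gain f v ?M)"
    by (rule submodular_union_le[OF sub]) (use MU OU finO in auto)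
  ultimately have upper: "f (?O \<union> ?M) \<le> f ?M + G"
    by (simp add: Un_commute)
  \<comment> \<open>The curvature bound speaks of singleton values, so the gains are first compared
    with these.\<close>
  have "G \<le> (\<Sum>m\<in>?M - ?O. f {m})"
    unfolding sM G_def
  proof (intro sum_mono)
    fix s m assume s: "s \<in> {1..t}" and m: "m \<in> M s - Opt s"
    have "gain f m (P s m) \<le> gain f m {}"
      by (rule gain_antimono[OF sub]) (use P(1)[OF s] m s MU in force)+
    then show "gain f m (P s m) \<le> f {m}"
      by (simp add: gain_def f0)
  qed
  then have "(1 - \<kappa>) * G \<le> (1 - \<kappa>) * (\<Sum>m\<in>?M - ?O. f {m})"
    using \<kappa> by (intro mult_left_mono) auto
  moreover have "f ?O + (1 - \<kappa>) * (\<Sum>v\<in>?M - ?O. f {v}) \<le> f (?O \<union> (?M - ?O))"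
    by (rule curvature_union_ge[OF curv]) (use MU OU MK(2) in auto)
  ultimately have lower: "f ?O + (1 - \<kappa>) * G \<le> f (?O \<union> ?M)"
    by simp
  \<comment> \<open>\<open>f ?M\<close> is the sum of all greedy gains; \<open>G\<close> omits some
    nonnegative ones.\<close>
  have "G \<le> f ?M"
    unfolding G_def P'(2)[symmetric] by (intro sum_mono sum_mono2) (use MK(2) g0 in auto)
  then have "\<kappa> * G \<le> \<kappa> * f ?M"
    using \<kappa> by (intro mult_left_mono) auto
  then show ?thesis
    using upper lower by (simp add: algebra_simps)
qed

section \<open>The greedy algorithm under a cardinality constraint\<close>

text \<open>
  \<open>greedy_factor \<kappa> m n\<close> is the fraction of the remaining value that is guaranteed by \<open>n\<close> further
  greedy steps when \<open>m\<close> elements of the competing set have not been selected yet. The geometric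
  sum is \<open>(1 - (1 - \<kappa> / m) ^ n) / \<kappa>\<close>, but also makes sense for \<open>\<kappa> = 0\<close>.
\<close>

definition greedy_factor :: "real \<Rightarrow> nat \<Rightarrow> nat \<Rightarrow> real" where
  "greedy_factor \<kappa> m n = (\<Sum>j<n. (1 - \<kappa> / real m) ^ j) / real m"

lemma one_minus_div_bounds:
  fixes \<kappa> :: real
  assumes "0 \<le> \<kappa>" "\<kappa> \<le> 1"
  shows "0 \<le> 1 - \<kappa> / real m" "1 - \<kappa> / real m \<le> 1"
proof -
  show "0 \<le> 1 - \<kappa> / real m"
  \<comment> \<open>Division by zero yields 0, so the expression is 1 for
    \<open>m = 0\<close>.\<close>
  proof (cases "m = 0")
    case False
    then have "\<kappa> \<le> real m" using assms by linarith
    then show ?thesis using False by simp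
  qed simp
qed (use assms in simp)

lemma greedy_factor_bounds:
  assumes "0 \<le> \<kappa>" "\<kappa> \<le> 1" "n \<le> m"
  shows "0 \<le> greedy_factor \<kappa> m n" "greedy_factor \<kappa> m n \<le> 1"
proof -
  note y = one_minus_div_bounds[OF assms(1,2), of m]
  show "0 \<le> greedy_factor \<kappa> m n"
    unfolding greedy_factor_def using y by (intro divide_nonneg_nonneg sum_nonneg) auto
  have "(\<Sum>j<n. (1 - \<kappa> / real m) ^ j) \<le> (\<Sum>j<n. 1)"
    using y by (intro sum_mono power_le_one) auto
  also have "\<dots> \<le> real m"
    using assms by simp
  finally show "greedy_factor \<kappa> m n \<le> 1"
    unfolding greedy_factor_def by (cases "m = 0") auto
qed

lemma greedy_factor_0 [simp]: "greedy_factor \<kappa> m 0 = 0"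
  by (simp add: greedy_factor_def)

text \<open>Split off the term \<open>j = 0\<close>. This is the recursion for a greedy step outside
  the competing set, which leaves \<open>m\<close> unchanged.\<close>

lemma greedy_factor_Suc:
  assumes "m > 0"
  shows "greedy_factor \<kappa> m (Suc n) = 1 / real m + (1 - \<kappa> / real m) * greedy_factor \<kappa> m n"
proof -
  have "(\<Sum>j<Suc n. (1 - \<kappa> / real m) ^ j) = 1 + (1 - \<kappa> / real m) * (\<Sum>j<n. (1 - \<kappa> / real m) ^ j)"
    by (subst sum.lessThan_Suc_shift) (simp add: sum_distrib_left)
  then show ?thesis
    by (simp add: greedy_factor_def add_divide_distrib)
qed

text \<open>The worst case is that greedy never picks an element of the competing set.\<close>

lemma greedy_factor_Suc_Suc:
  assumes \<kappa>: "0 \<le> \<kappa>" "\<kappa> \<le> 1" and n: "n \<le> m"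
  shows "greedy_factor \<kappa> (Suc m) (Suc n) \<le> 1 / real (Suc m) + (1 - 1 / real (Suc m)) * greedy_factor \<kappa> m n"
proof (cases "m = 0")
  case True
  then show ?thesis using n by (simp add: greedy_factor_def)
next
  case m: False
  define x y where "x = 1 - \<kappa> / real m" and "y = 1 - \<kappa> / real (Suc m)"
  have y0: "y > 0" and y1: "y \<le> 1"
    using \<kappa> m by (auto simp: y_def field_simps)
  have x0: "x \<ge> 0" 
    using one_minus_div_bounds(1)[OF \<kappa>] by (simp add: x_def)
  \<comment> \<open>The geometric sums are compared term by term, after a shift by one. Dividing by
    \<open>y ^ j\<close> leaves \<open>y \<le> (x / y) ^ j\<close>, which follows from Bernoulli's
    inequality.\<close>
  have pw: "y ^ Suc j \<le> x ^ j" if "j < n" for j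
  proof -
    have xy: "x / y - 1 = - \<kappa> / (real m * (real (Suc m) - \<kappa>))"
    proof -
      \<comment> \<open>\<open>D\<close> is \<open>real (Suc m) - \<kappa>\<close>; substituting for
        \<open>\<kappa>\<close> turns the denominator into an atom known to be nonzero.\<close>
      obtain D where D: "\<kappa> = real m + 1 - D"
        by (metis add_diff_cancel_left' diff_add_cancel)
      then have "D \<noteq> 0"
        using m \<kappa> by auto
      then show ?thesis
        using m unfolding x_def y_def D by (simp add: field_simps)
    qed
    \<comment> \<open>Here \<open>j < n \<le> m\<close> enters: it gives
      \<open>j * (m + 1) \<le> m\<^sup>2 - 1\<close>, enough for the linear bound that Bernoulli's
      inequality requires.\<close>
    have "real j \<le> real m - 1"
      using that n by linarith
    then have "real j * (real m + 1) \<le> (real m - 1) * (real m + 1)"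
      by (intro mult_right_mono) auto
    also have "\<dots> \<le> real m * real m"
      by (simp add: algebra_simps)
    also have "\<dots> \<le> real m * (real (Suc m) - \<kappa>)"
      using \<kappa> by (intro mult_left_mono) auto
    finally have "\<kappa> * (real j * (real m + 1)) \<le> \<kappa> * (real m * (real (Suc m) - \<kappa>))"
      using \<kappa> by (intro mult_left_mono) auto
    moreover have "real m * (real (Suc m) - \<kappa>) > 0"
      using m \<kappa> by simp
    ultimately have "real j * \<kappa> / (real m * (real (Suc m) - \<kappa>)) \<le> \<kappa> / real (Suc m)"
      using m by (simp add: divide_simps algebra_simps)
    then have "y \<le> 1 + real j * (x / y - 1)"
      unfolding xy by (simp add: y_def)
    also have "\<dots> \<le> (1 + (x / y - 1)) ^ j"
      by (rule Bernoulli_inequality) (use x0 y0 in simp)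
    finally have "y \<le> x ^ j / y ^ j"
      by (simp add: power_divide)
    then show ?thesis
      using y0 by (simp add: pos_le_divide_eq)
  qed
  have "real (Suc m) * greedy_factor \<kappa> (Suc m) (Suc n) = 1 + (\<Sum>j<n. y ^ Suc j)"
    unfolding greedy_factor_def y_def[symmetric] by (subst sum.lessThan_Suc_shift) simp
  also have "\<dots> \<le> 1 + (\<Sum>j<n. x ^ j)"
    using pw by (intro add_left_mono sum_mono) auto
  also have "\<dots> = 1 + real m * greedy_factor \<kappa> m n"
    using m by (simp add: greedy_factor_def x_def)
  finally show ?thesis
    by (simp add: divide_simps algebra_simps)
qed

text \<open>Sum the geometric series and use
  \<open>1 - \<kappa> / k \<le> exp (- \<kappa> / k)\<close>. For \<open>\<kappa> = 0\<close> both
  sides equal 1.\<close>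

lemma curvature_factor_le_greedy_factor:
  assumes \<kappa>: "0 \<le> \<kappa>" "\<kappa> \<le> 1" and k: "k > 0"
  shows "curvature_factor \<kappa> \<le> greedy_factor \<kappa> k k"
proof (cases "\<kappa> = 0")
  case True
  then show ?thesis
    using k by (simp add: curvature_factor_def greedy_factor_def)
next
  case False
  let ?y = "1 - \<kappa> / real k"
  have "?y ^ k \<le> exp (- \<kappa> / real k) ^ k"
    using one_minus_div_bounds(1)[OF \<kappa>] exp_ge_add_one_self[of "- \<kappa> / real k"]
    by (intro power_mono) auto
  also have "\<dots> = exp (- \<kappa>)"
    using k by (simp add: exp_of_nat_mult[symmetric])
  finally have "1 - exp (- \<kappa>) \<le> 1 - ?y ^ k" by simp
  moreover have "greedy_factor \<kappa> k k = (1 - ?y ^ k) / \<kappa>"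
    using False k by (simp add: greedy_factor_def sum_gp_strict)
  ultimately show ?thesis
    using False \<kappa> by (simp add: curvature_factor_def divide_right_mono)
qed

text \<open>One greedy step: \<open>h\<close> is the value still missing, \<open>a\<close> the gain,
  \<open>p\<close> the fraction guaranteed afterwards, and \<open>w * a\<close> the decrease of
  \<open>h\<close>. As \<open>1 - w * p\<close> is nonnegative, \<open>h / m\<close> may be replaced
  by \<open>a\<close>. It is used with \<open>w = 1\<close> and with
  \<open>w = \<kappa>\<close>.\<close>

lemma remaining_value_step:
  fixes h a p w m :: real
  assumes "0 \<le> p" "w * p \<le> 1" "h \<le> m * a" "0 \<le> a" "m > 0"
  shows "max 0 h * (1 / m + (1 - w / m) * p) \<le> a + max 0 (h - w * a) * p"
proof (cases "h \<ge> 0")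
  case True
  have "h / m \<le> a"
    using assms by (simp add: divide_le_eq mult.commute)
  have "h * (1 / m + (1 - w / m) * p) = h / m * (1 - w * p) + h * p"
    by (simp add: algebra_simps)
  also have "\<dots> \<le> a * (1 - w * p) + h * p"
    using \<open>h / m \<le> a\<close> assms by (intro add_right_mono mult_right_mono) auto
  also have "\<dots> = a + (h - w * a) * p"
    by (simp add: algebra_simps)
  also have "\<dots> \<le> a + max 0 (h - w * a) * p"
    using assms by (intro add_left_mono mult_right_mono) auto
  finally show ?thesis
    using True by simp
qed (use assms in simp)

text \<open>
  The second summand bounds what the remaining steps still gain: the sum of the gains realized
  outside the competing set enters through \<open>L\<close>, since curvature makes these elements increase the
  value of the competing set.
\<close>

lemma greedy_reachable_invariant:
  fixes \<kappa> :: real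
  assumes KU: "K \<subseteq> U" and U: "finite U"
    and mono: "mono_on (Pow U) f" and f0: "f {} = 0" and sub: "submodular_on U f"
    and \<kappa>: "0 \<le> \<kappa>" "\<kappa> \<le> 1"
    and curv: "\<And>v S. v \<in> U \<Longrightarrow> S \<subseteq> U \<Longrightarrow> v \<notin> S \<Longrightarrow> (1 - \<kappa>) * f {v} \<le> gain f v S"
    and Opt: "Opt \<subseteq> K" "card Opt = k"
    and greedy: "greedy_reachable f K k S"
  shows "\<exists>L \<le> (\<Sum>v\<in>S - Opt. f {v}). f Opt * greedy_factor \<kappa> k k \<le>
     f S + max 0 (f Opt - f S + (1 - \<kappa>) * L) * greedy_factor \<kappa> (card (Opt - S)) (k - card S)"
  using greedy
proof induction
  case start
  then show ?case
    using Opt(2) f0 by (intro exI[of _ 0]) (auto intro!: mult_right_mono greedy_factor_bounds(1) \<kappa>)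
next
  case (step S x)
  obtain L where L: "L \<le> (\<Sum>v\<in>S - Opt. f {v})"
    and inv: "f Opt * greedy_factor \<kappa> k k \<le> f S + max 0 (f Opt - f S + (1 - \<kappa>) * L) *
        greedy_factor \<kappa> (card (Opt - S)) (k - card S)"
    using step.IH by blast
  have S: "S \<subseteq> K" "finite S"
    using greedy_reachable_bounds[OF step.hyps(1)] by auto
  have x: "x \<in> K" "x \<notin> S" and best: "\<And>v. v \<in> K - S \<Longrightarrow> gain f v S \<le> gain f x S"
    using step.hyps(3) by (auto simp: is_arg_max_def not_less gain_def)
  have finO: "finite Opt"
    using Opt(1) KU U by (meson finite_subset)
  define a h m n where "a = gain f x S" and "h = f Opt - f S + (1 - \<kappa>) * L"
    and "m = card (Opt - S)" and "n = k - Suc (card S)"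
  have Suc_n: "k - card S = Suc n"
    using step.hyps(2) by (simp add: n_def)
  \<comment> \<open>At least as many competing elements as greedy steps remain, as the bounds on
    \<open>greedy_factor\<close> require.\<close>
  have "k \<le> m + card S"
    using Opt(2) diff_card_le_card_Diff[OF S(2), of Opt] by (simp add: m_def)
  then have nm: "Suc n \<le> m"
    using Suc_n by linarith
  have inv': "f Opt * greedy_factor \<kappa> k k \<le> f S + max 0 h * greedy_factor \<kappa> m (Suc n)"
    using inv unfolding h_def m_def Suc_n .
  have cx: "k - card (S \<union> {x}) = n"
    using S x by (simp add: n_def)
  have a0: "a \<ge> 0"
    unfolding a_def by (rule gain_nonneg[OF mono]) (use x S KU in auto)
  have fS': "f (S \<union> {x}) = f S + a"
    by (simp add: a_def gain_def)
  \<comment> \<open>The value of \<open>Opt \<union> S\<close> is bounded below by curvature and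
    above by \<open>m\<close> gains, none larger than the greedy one.\<close>
  have h: "h \<le> real m * a"
  proof -
    have "f Opt + (1 - \<kappa>) * (\<Sum>v\<in>S - Opt. f {v}) \<le> f (Opt \<union> (S - Opt))"
      by (rule curvature_union_ge[OF curv]) (use S Opt KU in auto)
    moreover have "(1 - \<kappa>) * L \<le> (1 - \<kappa>) * (\<Sum>v\<in>S - Opt. f {v})"
      using L \<kappa> by (intro mult_left_mono) auto
    moreover have "f (S \<union> (Opt - S)) \<le> f S + (\<Sum>v\<in>Opt - S. gain f v S)"
      by (rule submodular_union_le[OF sub]) (use S Opt KU finO in auto)
    moreover have "(\<Sum>v\<in>Opt - S. gain f v S) \<le> (\<Sum>v\<in>Opt - S. a)"
      unfolding a_def by (intro sum_mono best) (use Opt in auto)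
    ultimately show ?thesis
      by (simp add: h_def m_def Un_commute)
  qed
  show ?case
  \<comment> \<open>If \<open>x\<close> is in \<open>Opt\<close>, then \<open>L\<close> stays and
    \<open>h\<close> falls by \<open>a\<close>, while \<open>m\<close> drops by one. Otherwise
    \<open>m\<close> stays and \<open>L\<close> grows by \<open>a\<close>, so \<open>h\<close> falls
    only by \<open>\<kappa> * a\<close>.\<close>
  proof (cases "x \<in> Opt")
    case True
    define m' where "m' = card (Opt - (S \<union> {x}))"
    have m: "m = Suc m'"
    proof -
      have "Opt - (S \<union> {x}) = Opt - S - {x}"
        by blast
      then show ?thesis
        unfolding m_def m'_def using card.remove[of "Opt - S" x] True x finO by simp
    qed
    let ?p = "greedy_factor \<kappa> m' n"
    have p: "0 \<le> ?p" "?p \<le> 1"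
      using greedy_factor_bounds[OF \<kappa>] nm m by simp_all
    have "max 0 h * greedy_factor \<kappa> m (Suc n) \<le> max 0 h * (1 / real m + (1 - 1 / real m) * ?p)"
      unfolding m by (rule mult_left_mono[OF greedy_factor_Suc_Suc[OF \<kappa>]]) (use nm m in auto)
    also have "\<dots> \<le> a + max 0 (h - 1 * a) * ?p"
      by (rule remaining_value_step) (use p h a0 nm in auto)
    finally have "max 0 h * greedy_factor \<kappa> m (Suc n) \<le> a + max 0 (h - a) * ?p"
      by simp
    moreover have hx: "f Opt - f (S \<union> {x}) + (1 - \<kappa>) * L = h - a"
      unfolding h_def fS' by simp
    ultimately have "f Opt * greedy_factor \<kappa> k k \<le>
        f (S \<union> {x}) + max 0 (f Opt - f (S \<union> {x}) + (1 - \<kappa>) * L) *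
          greedy_factor \<kappa> (card (Opt - (S \<union> {x}))) (k - card (S \<union> {x}))"
      unfolding hx cx m'_def[symmetric] using inv' fS' by linarith
    moreover have "S \<union> {x} - Opt = S - Opt"
      using True by auto
    ultimately show ?thesis
      using L by auto
  next
    case False
    let ?p = "greedy_factor \<kappa> m n"
    have p: "0 \<le> ?p" "?p \<le> 1"
      using greedy_factor_bounds[OF \<kappa>] nm by simp_all
    have kp: "\<kappa> * ?p \<le> 1"
      using mult_mono[OF \<kappa>(2) p(2)] p by simp
    have "max 0 h * greedy_factor \<kappa> m (Suc n) = max 0 h * (1 / real m + (1 - \<kappa> / real m) * ?p)"
      using nm by (simp add: greedy_factor_Suc)
    also have "\<dots> \<le> a + max 0 (h - \<kappa> * a) * ?p"
      by (rule remaining_value_step) (use p kp h a0 nm in auto)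
    finally have "max 0 h * greedy_factor \<kappa> m (Suc n) \<le> a + max 0 (h - \<kappa> * a) * ?p" .
    moreover have hx: "f Opt - f (S \<union> {x}) + (1 - \<kappa>) * (L + a) = h - \<kappa> * a"
      unfolding h_def fS' by (simp add: algebra_simps)
    moreover have mx: "card (Opt - (S \<union> {x})) = m"
      using False by (auto simp: m_def intro!: arg_cong[where f = card])
    ultimately have "f Opt * greedy_factor \<kappa> k k \<le>
        f (S \<union> {x}) + max 0 (f Opt - f (S \<union> {x}) + (1 - \<kappa>) * (L + a)) *
          greedy_factor \<kappa> (card (Opt - (S \<union> {x}))) (k - card (S \<union> {x}))"
      unfolding hx cx mx using inv' fS' by linarith
    moreover have "L + a \<le> (\<Sum>v\<in>S \<union> {x} - Opt. f {v})"
    proof -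
      have "a \<le> f {x}"
        using gain_antimono[OF sub, of "{}" S x] x S KU f0 by (auto simp: a_def gain_def)
      moreover have "S \<union> {x} - Opt = insert x (S - Opt)"
        using False by auto
      ultimately show ?thesis
        using L S x by simp
    qed
    ultimately show ?thesis
      by blast
  qed
qed

text \<open>After \<open>k\<close> picks no steps remain, so the factor in the second summand of the
  invariant vanishes and only \<open>f S\<close> is left. The case \<open>k = 0\<close> is separate
  because the bound on \<open>greedy_factor\<close> needs \<open>k > 0\<close>.\<close>

lemma greedy_output_curvature:
  fixes \<kappa> :: real
  assumes "K \<subseteq> U" "finite U" "mono_on (Pow U) f" "f {} = 0" "submodular_on U f"
    and \<kappa>: "0 \<le> \<kappa>" "\<kappa> \<le> 1"
    and "\<And>v S. v \<in> U \<Longrightarrow> S \<subseteq> U \<Longrightarrow> v \<notin> S \<Longrightarrow> (1 - \<kappa>) * f {v} \<le> gain f v S"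
    and Opt: "Opt \<subseteq> K" "card Opt = k"
    and greedy: "greedy_output f K k S"
  shows "curvature_factor \<kappa> * f Opt \<le> f S"
proof (cases "k = 0")
  case True
  moreover have "finite Opt"
    using assms(1,2) Opt(1) by (meson finite_subset)
  ultimately have "Opt = {}" "S = {}"
    using Opt greedy_output_bounds[OF greedy] by auto
  then show ?thesis
    using assms(4) by simp
next
  case False
  have "f Opt * greedy_factor \<kappa> k k \<le> f S"
    using greedy_reachable_invariant[OF assms(1-10), of S] greedy greedy_output_bounds(3)[OF greedy]
    by (auto simp: greedy_output_def)
  moreover have "f {} \<le> f Opt"
    by (rule mono_onD[OF assms(3)]) (use Opt assms(1) in auto)
  then have "f Opt * curvature_factor \<kappa> \<le> f Opt * greedy_factor \<kappa> k k"
    using curvature_factor_le_greedy_factor[OF \<kappa>] False assms(4) by (intro mult_left_mono) auto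
  ultimately show ?thesis
    by (simp add: mult.commute)
qed

section \<open>The robust problem and the bisection\<close>

lemma top_elements_bounds:
  assumes "top_elements f W b S" "b \<le> card W"
  shows "S \<subseteq> W" "finite S" "card S = b"
proof -
  obtain vs where vs: "distinct vs" "set vs = W" "S = set (take b vs)"
    using assms(1) unfolding top_elements_def by blast
  then show "S \<subseteq> W" "finite S"
    using set_take_subset by fastforce+
  have "length vs = card W"
    using vs distinct_card by metis
  then show "card S = b"
    using vs assms(2) by (simp add: distinct_card)
qed

text \<open>The adversary can always discard the elements of \<open>D s\<close>.\<close>

lemma rsm_value_le:
  assumes "distinct ss"
    and "\<And>s. s \<in> set ss \<Longrightarrow> finite (V s) \<and> finite (D s) \<and> card (D s) \<le> \<beta> s \<and> \<beta> s \<le> \<alpha> s \<and> \<alpha> s \<le> card (V s)"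
  shows "\<exists>P. (\<forall>s\<in>set ss. P s \<subseteq> V s - D s \<and> card (P s) = \<alpha> s - \<beta> s) \<and>
           rsm_value f V \<alpha> \<beta> ss X \<le> f (X \<union> (\<Union>s\<in>set ss. P s))"
  using assms
proof (induction ss arbitrary: X)
  case Nil
  then show ?case by simp
next
  case (Cons s ss)
  have s: "finite (V s)" "finite (D s)" "card (D s) \<le> \<beta> s" "\<beta> s \<le> \<alpha> s" "\<alpha> s \<le> card (V s)"
    using Cons.prems(2)[of s] by auto
  define \<A> where "\<A> = {A. A \<subseteq> V s \<and> card A = \<alpha> s}"
  define h where "h A = (MIN B\<in>{B. B \<subseteq> A \<and> card B \<le> \<beta> s}. rsm_value f V \<alpha> \<beta> ss (X \<union> (A - B)))" for A
  have "finite \<A>"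
    using s(1) by (auto simp: \<A>_def)
  moreover have "\<A> \<noteq> {}"
    using obtain_subset_with_card_n[OF s(5)] by (auto simp: \<A>_def)
  ultimately have "Max (h ` \<A>) \<in> h ` \<A>"
    by (intro Max_in) auto
  then obtain A where A: "A \<subseteq> V s" "card A = \<alpha> s" and val: "rsm_value f V \<alpha> \<beta> (s # ss) X = h A"
    by (auto simp: \<A>_def h_def)
  have finA: "finite A"
    using A s(1) by (meson finite_subset)
  have "card (A \<inter> D s) \<le> \<beta> s"
    using s(2,3) card_mono[of "D s" "A \<inter> D s"] by auto
  \<comment> \<open>The adversary's answer to \<open>A\<close> covers the part of \<open>A\<close>
    in \<open>D s\<close> and is padded to exactly \<open>\<beta> s\<close> elements, so that
    exactly \<open>\<alpha> s - \<beta> s\<close> survive.\<close>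
  then obtain B where B: "A \<inter> D s \<subseteq> B" "B \<subseteq> A" "card B = \<beta> s"
    using exists_subset_between[of "A \<inter> D s" "\<beta> s" A] A s(4) finA by auto
  have "h A \<le> rsm_value f V \<alpha> \<beta> ss (X \<union> (A - B))"
    unfolding h_def using finA B by (intro Min_le) auto
  moreover obtain P where P: "\<forall>r\<in>set ss. P r \<subseteq> V r - D r \<and> card (P r) = \<alpha> r - \<beta> r"
      "rsm_value f V \<alpha> \<beta> ss (X \<union> (A - B)) \<le> f (X \<union> (A - B) \<union> (\<Union>r\<in>set ss. P r))"
    using Cons.IH[of "X \<union> (A - B)"] Cons.prems by auto
  define P' where "P' = P(s := A - B)"
  have "s \<notin> set ss"
    using Cons.prems by simp
  then have UN: "(\<Union>r\<in>set ss. P' r) = (\<Union>r\<in>set ss. P r)" and P': "\<forall>r\<in>set ss. P' r = P r"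
    by (auto simp: P'_def)
  have "card (A - B) = \<alpha> s - \<beta> s"
    using A B finA by (metis card_Diff_subset finite_subset)
  then have "\<forall>r\<in>set (s # ss). P' r \<subseteq> V r - D r \<and> card (P' r) = \<alpha> r - \<beta> r"
    using P(1) P' A B by (auto simp: P'_def)
  moreover have "X \<union> (A - B) \<union> (\<Union>r\<in>set ss. P r) = X \<union> (\<Union>r\<in>set (s # ss). P' r)"
  proof -
    have "P' s = A - B"
      by (simp add: P'_def)
    then show ?thesis
      using UN by simp blast
  qed
  ultimately show ?case
    using P(2) val by (intro exI[of _ P']) auto
qed

lemma f_star_le:
  assumes "\<And>s. s \<in> {1..t} \<Longrightarrow> finite (V s) \<and> finite (D s) \<and> card (D s) \<le> \<beta> s \<and> \<beta> s \<le> \<alpha> s \<and> \<alpha> s \<le> card (V s)"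
  shows "\<exists>P. (\<forall>s\<in>{1..t}. P s \<subseteq> V s - D s \<and> card (P s) = \<alpha> s - \<beta> s) \<and>
           f_star f V \<alpha> \<beta> t \<le> f (\<Union>s\<in>{1..t}. P s)"
proof -
  have set: "set [1..<Suc t] = {1..t}"
    by (simp add: atLeastLessThanSuc_atLeastAtMost del: upt_Suc)
  show ?thesis
    using rsm_value_le[of "[1..<Suc t]" V D \<beta> \<alpha> f "{}"] assms
    unfolding set f_star_def by simp
qed

text \<open>The lower end starts at 0 and only ever moves to a midpoint that failed the test
  \<open>card (Bh m) < b\<close>.\<close>

lemma bisection_result:
  assumes "\<epsilon> > 0" "u0 > 0"
  shows "bisection Bh b \<epsilon> u0 = 0 \<or> bisection Bh b \<epsilon> u0 > 0 \<and> b \<le> card (Bh (bisection Bh b \<epsilon> u0))"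
proof -
  let ?I = "\<lambda>(l :: real, u :: real). l < u \<and> (l = 0 \<or> l > 0 \<and> b \<le> card (Bh l))"
  let ?c = "\<lambda>(l :: real, u). u - l > \<epsilon>"
  let ?f = "\<lambda>(l :: real, u). let m = (l + u) / 2 in if card (Bh m) < b then (l, m) else (m, u)"
  have "case while ?c ?f (0, u0) of (l, u) \<Rightarrow> l = 0 \<or> l > 0 \<and> b \<le> card (Bh l)"
  \<comment> \<open>Each round halves the interval. With \<open>w = (u - l) / \<epsilon> > 1\<close>
    the argument of the ceiling goes from \<open>2 * w\<close> to \<open>w\<close>, a drop by more
    than 1, so the measure decreases strictly.\<close>
  proof (rule while_rule[where P = ?I and r = "Wellfounded.measure (\<lambda>(l, u). nat \<lceil>2 * (u - l) / \<epsilon>\<rceil>)"])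
    show "?I (?f p)" if "?I p" "?c p" for p
      using that by (auto simp: Let_def split: prod.splits if_splits)
    show "(?f p, p) \<in> Wellfounded.measure (\<lambda>(l, u). nat \<lceil>2 * (u - l) / \<epsilon>\<rceil>)" if "?I p" "?c p" for p
    proof -
      obtain l u where p: "p = (l, u)" by fastforce
      define w where "w = (u - l) / \<epsilon>"
      have w: "w > 1"
        using that p assms by (simp add: w_def)
      have "\<lceil>w\<rceil> < \<lceil>2 * w\<rceil>"
        using w by linarith
      moreover have "2 * (u - l) / \<epsilon> = 2 * w" "2 * ((l + u) / 2 - l) / \<epsilon> = w"
          "2 * (u - (l + u) / 2) / \<epsilon> = w"
        using assms(1) by (simp_all add: w_def divide_simps)
      ultimately show ?thesis
        using w p by (auto simp: Let_def)
    qed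
  qed (use assms in auto)
  then show ?thesis
    unfolding bisection_def by (simp add: case_prod_unfold)
qed

lemma survivors_step:
  assumes "t \<ge> 1"
  shows "survivors A B t = survivors A B (t - 1) \<union> (A t - B t)"
proof -
  have "{1..t} = insert t {1..t - 1}"
    using assms by auto
  then show ?thesis
    by (auto simp: survivors_def)
qed

lemma f_hat_le_survivors:
  assumes t: "t \<in> {1..T}" and wc: "worst_case_removals f \<beta> T A B"
    and pen: "penalized_solutions f T A B Bhat"
    and bis: "bisection_returns (Bhat t) (\<beta> t) l"
  shows "f_hat f A B Bhat t l \<le> f (survivors A B t)"
proof -
  have B: "B t \<subseteq> A t" "card (B t) \<le> \<beta> t"
    using wc t by (auto simp: worst_case_removals_def is_arg_min_def)
  have l: "l = 0 \<or> l > 0 \<and> \<beta> t \<le> card (Bhat t l)"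
    using bis bisection_result unfolding bisection_returns_def by blast
  have l0: "l \<ge> 0"
    using l by auto
  have "is_arg_min (\<lambda>X. f (survivors A B (t - 1) \<union> (A t - X)) + l * real (card X))
          (\<lambda>X. X \<subseteq> A t) (Bhat t l)"
    using pen t l0 unfolding penalized_solutions_def by blast
  then have "f_hat f A B Bhat t l + l * real (card (Bhat t l)) \<le> f (survivors A B t) + l * real (card (B t))"
    using B survivors_step[of t A B] t unfolding is_arg_min_def f_hat_def by (simp add: not_less)
  moreover have "l * real (card (B t)) \<le> l * real (card (Bhat t l))"
    using l B by (cases "l = 0") (auto intro!: mult_left_mono)
  ultimately show ?thesis by linarith
qed

section \<open>The approximation guarantees\<close>

theorem corollary15:
  fixes T :: nat
    and V :: "nat \<Rightarrow> 'a set"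
    and f :: "'a set \<Rightarrow> real"
    and \<alpha> \<beta> :: "nat \<Rightarrow> nat"
    and A B S1 M :: "nat \<Rightarrow> 'a set"
    and Bhat :: "nat \<Rightarrow> real \<Rightarrow> 'a set"
  assumes "T \<ge> 1"
    and "\<forall>t\<in>{1..T}. finite (V t)"
    and "disjoint_family_on V {1..T}"
    and "mono_on (Pow (ground_set V T)) f"
    and "f {} = 0"
    and "\<forall>t\<in>{1..T}. \<beta> t \<le> \<alpha> t \<and> \<alpha> t \<le> card (V t)"
    and "ram_run f V \<alpha> \<beta> T B S1 A"
    and "worst_case_removals f \<beta> T A B"
    and "failure_free_greedy f V \<alpha> \<beta> T S1 M"
    and "penalized_solutions f T A B Bhat"
  shows "\<forall>t\<in>{1..T}.
    card (A t) \<le> \<alpha> t \<and>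
    (\<forall>l. bisection_returns (Bhat t) (\<beta> t) l \<and>
         f_star f V \<alpha> \<beta> t > 0 \<and> f (\<Union>s\<in>{1..t}. M s) > 0 \<longrightarrow>
       (submodular_on (ground_set V T) f \<and> (\<forall>v\<in>ground_set V T. f {v} \<noteq> 0) \<longrightarrow>
          f (survivors A B t) / f_star f V \<alpha> \<beta> t \<ge>
            (if t = 1
             then curvature_factor (curvature (ground_set V T) f) *
                    (f_hat f A B Bhat 1 l / f (M 1))
             else 1 / (1 + curvature (ground_set V T) f) *
                    (f_hat f A B Bhat t l / f (\<Union>s\<in>{1..t}. M s)))) \<and>
       (\<forall>c. c_submodular (ground_set V T) f c \<longrightarrow>
          f (survivors A B t) / f_star f V \<alpha> \<beta> t \<ge>
            (1 - c) * (f_hat f A B Bhat t l / f (\<Union>s\<in>{1..t}. M s))))"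
proof -
  note fin = assms(2) and disj = assms(3) and mono = assms(4) and f0 = assms(5) and ab = assms(6)
  note ram = assms(7) and wc = assms(8) and ff = assms(9) and pen = assms(10)
  let ?U = "ground_set V T"
  \<comment> \<open>What remains after removing \<open>S1 s\<close>: both the failure-free greedy
    sets and the competitor choose from it.\<close>
  define K where "K s = V s - S1 s" for s
  have finU: "finite ?U"
    using fin by (simp add: ground_set_def)
  have S1: "S1 s \<subseteq> V s" "finite (S1 s)" "card (S1 s) = \<beta> s" if s: "s \<in> {1..T}" for s
  proof -
    have "top_elements f (V s) (\<beta> s) (S1 s)" "\<beta> s \<le> card (V s)"
      using ram ab s unfolding ram_run_def by (blast, fastforce)
    then show "S1 s \<subseteq> V s" "finite (S1 s)" "card (S1 s) = \<beta> s"
      by (rule top_elements_bounds)+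
  qed
  have A: "A s \<subseteq> V s" "card (A s) \<le> \<alpha> s" if s: "s \<in> {1..T}" for s
  proof -
    obtain S2 where S2: "greedy_output (\<lambda>S. f (survivors A B (s - 1) \<union> S)) (V s - S1 s) (\<alpha> s - \<beta> s) S2"
        "A s = S1 s \<union> S2"
      using ram s unfolding ram_run_def by blast
    show "A s \<subseteq> V s"
      using S2 S1[OF s] greedy_output_bounds(1)[OF S2(1)] by auto
    show "card (A s) \<le> \<alpha> s"
      using S2 S1[OF s] greedy_output_bounds(3)[OF S2(1)] ab s card_Un_le[of "S1 s" S2] by fastforce
  qed
  have greedy: "greedy_output (\<lambda>S. f ((\<Union>r\<in>{1..<s}. M r) \<union> S)) (K s) (\<alpha> s - \<beta> s) (M s)"
    if "s \<in> {1..T}" for s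
    using ff that unfolding failure_free_greedy_def K_def by blast
  have KU: "K s \<subseteq> ?U" if "s \<in> {1..T}" for s
    using that by (auto simp: K_def ground_set_def)
  show ?thesis
  proof (intro ballI conjI allI impI)
    fix t assume t: "t \<in> {1..T}"
    show "card (A t) \<le> \<alpha> t"
      using A t by blast
    fix l assume hyp: "bisection_returns (Bhat t) (\<beta> t) l \<and> f_star f V \<alpha> \<beta> t > 0 \<and> f (\<Union>s\<in>{1..t}. M s) > 0"
    let ?M = "\<Union>s\<in>{1..t}. M s"
    have sub: "s \<in> {1..T}" if "s \<in> {1..t}" for s
      using that t by auto
    have "\<exists>Opt. (\<forall>s\<in>{1..t}. Opt s \<subseteq> V s - S1 s \<and> card (Opt s) = \<alpha> s - \<beta> s) \<and>
        f_star f V \<alpha> \<beta> t \<le> f (\<Union>s\<in>{1..t}. Opt s)"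
    proof (rule f_star_le)
      fix s assume "s \<in> {1..t}"
      from sub[OF this] show "finite (V s) \<and> finite (S1 s) \<and> card (S1 s) \<le> \<beta> s \<and>
          \<beta> s \<le> \<alpha> s \<and> \<alpha> s \<le> card (V s)"
        using fin S1 ab by auto
    qed
    then obtain Opt where Opt': "\<forall>s\<in>{1..t}. Opt s \<subseteq> K s \<and> card (Opt s) = \<alpha> s - \<beta> s"
      and star: "f_star f V \<alpha> \<beta> t \<le> f (\<Union>s\<in>{1..t}. Opt s)"
      unfolding K_def by (elim exE conjE)
    note Opt = bspec[OF Opt']
    have disjK: "disjoint_family_on K {1..t}"
      using disj sub unfolding disjoint_family_on_def K_def by blast
    have "survivors A B (t - 1) \<union> (A t - Bhat t l) \<subseteq> ?U"
    proof -
      have AU: "A s \<subseteq> ?U" if "s \<in> {1..T}" for s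
        using A(1)[OF that] that unfolding ground_set_def by blast
      have "A s - B s \<subseteq> ?U" if "s \<in> {1..t - 1}" for s
      proof -
        have "s \<in> {1..T}"
          using that t by auto
        then show ?thesis
          using AU by blast
      qed
      then show ?thesis
        using AU[OF t] unfolding survivors_def by blast
    qed
    then have "f {} \<le> f_hat f A B Bhat t l"
      unfolding f_hat_def by (intro mono_onD[OF mono]) auto
    then have fh0: "f_hat f A B Bhat t l \<ge> 0"
      using f0 by simp
    have fh: "f_hat f A B Bhat t l \<le> f (survivors A B t)"
      using f_hat_le_survivors[OF t wc pen] hyp by blast
    \<comment> \<open>All guarantees reduce to comparing greedy with \<open>Opt\<close>: from
      \<open>q * f_star \<le> f ?M\<close> follows \<open>q / f ?M \<le> 1 / f_star\<close>, to be
      multiplied by \<open>f_hat \<le> f (survivors A B t)\<close>.\<close>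
    have ratio: "q * (f_hat f A B Bhat t l / f ?M) \<le> f (survivors A B t) / f_star f V \<alpha> \<beta> t"
      if q: "q * f (\<Union>s\<in>{1..t}. Opt s) \<le> f ?M" "q \<ge> 0" for q
    proof -
      have "q * f_star f V \<alpha> \<beta> t \<le> f ?M"
        using mult_left_mono[OF star q(2)] q(1) by linarith
      then have "q / f ?M \<le> 1 / f_star f V \<alpha> \<beta> t"
        using hyp by (simp add: divide_simps mult_ac)
      then have "f_hat f A B Bhat t l * (q / f ?M) \<le> f (survivors A B t) * (1 / f_star f V \<alpha> \<beta> t)"
        using fh fh0 hyp q(2) by (intro mult_mono) auto
      then show ?thesis by (simp add: mult_ac)
    qed
    {
      assume subm: "submodular_on ?U f \<and> (\<forall>v\<in>?U. f {v} \<noteq> 0)"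
      \<comment> \<open>The minimum in \<open>curvature\<close> is meaningful only over a nonempty
        ground set, and \<open>f ?M > 0\<close> provides an element.\<close>
      have "?M \<noteq> {}"
        using hyp f0 by (metis less_irrefl)
      then have "?U \<noteq> {}"
        using greedy_output_bounds(1)[OF greedy[OF sub]] KU[OF sub] by blast
      note curv = curvature_bounds[OF finU this mono f0 conjunct1[OF subm] conjunct2[OF subm]]
      let ?\<kappa> = "curvature ?U f"
      show "f (survivors A B t) / f_star f V \<alpha> \<beta> t \<ge>
            (if t = 1
             then curvature_factor ?\<kappa> * (f_hat f A B Bhat 1 l / f (M 1))
             else 1 / (1 + ?\<kappa>) * (f_hat f A B Bhat t l / f ?M))"
      proof (cases "t = 1")
        case True
        have "curvature_factor ?\<kappa> * f (Opt 1) \<le> f (M 1)"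
        proof (rule greedy_output_curvature[OF _ finU mono f0 conjunct1[OF subm] curv])
          show "greedy_output f (K 1) (\<alpha> 1 - \<beta> 1) (M 1)"
            using greedy[of 1] t True by simp
        qed (use KU Opt t True in auto)
        moreover have "curvature_factor ?\<kappa> \<ge> 0"
          using curv(1) by (auto simp: curvature_factor_def)
        ultimately show ?thesis
          using ratio[of "curvature_factor ?\<kappa>"] True by simp
      next
        case False
        have "f (\<Union>s\<in>{1..t}. Opt s) \<le> (1 + ?\<kappa>) * f ?M"
          by (rule sequential_greedy_curvature[OF disjK KU[OF sub] finU mono f0 conjunct1[OF subm]
                curv greedy[OF sub] Opt])
        then have "1 / (1 + ?\<kappa>) * f (\<Union>s\<in>{1..t}. Opt s) \<le> f ?M"
          using curv(1) by (simp add: divide_simps mult_ac)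
        then show ?thesis
          using ratio[of "1 / (1 + ?\<kappa>)"] curv(1) False by simp
      qed
    }
    fix c assume "c_submodular ?U f c"
    then have c: "c = total_curvature ?U f"
      by (simp add: c_submodular_def)
    show "f (survivors A B t) / f_star f V \<alpha> \<beta> t \<ge> (1 - c) * (f_hat f A B Bhat t l / f ?M)"
      unfolding c
    proof (rule ratio)
      show "(1 - total_curvature ?U f) * f (\<Union>s\<in>{1..t}. Opt s) \<le> f ?M"
        by (rule sequential_greedy_total_curvature[OF disjK KU[OF sub] finU mono f0 greedy[OF sub] Opt])
      show "1 - total_curvature ?U f \<ge> 0"
        using total_curvature_bounds(1)[OF finU mono] by simp
    qed
  qed
qed

end
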